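(* The Fourier dimension is not invariant under $C^m$-diffeomorphisms for any $m$: for every positive integer $m$ there exist a Borel set $F\subset\mathbf{R}$ and a $C^m$-diffeomorphism $f:\mathbf{R}\to\mathbf{R}$ such that $\dim_{\mathrm{F}} f(F)\neq\dim_{\mathrm{F}} F$.
   Context: The Fourier transform of a Borel probability measure $\mu$ on $\mathbf{R}$ is $\widehat\mu(\xi) = \int e^{-2\pi i \xi x}\,\mathrm{d}\mu(x)$. The Fourier dimension of $\mu$ is $\dim_{\mathrm{F}} \mu = \sup\{ s \in [0,1] : |\widehat\mu(\xi)|\,|\xi|^{s/2} \text{ is bounded in } \xi\}$. The Fourier dimension of a Borel set $F \subset \mathbf{R}$ is $\dim_{\mathrm{F}} F = \sup\{\dim_{\mathrm{F}} \mu : \mu \text{ a Borel probability measure on } \mathbf{R},\ \mu(F) = 1\}$ (with value $0$ if $F=\emptyset$). A $C^m$-diffeomorphism of $\mathbf{R}$ is an $m$ times continuously differentiable bijection whose inverse is $m$ times continuously differentiable. *)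

theory Defs
  imports "HOL-Probability.Probability"
begin

definition fourier_transform :: "real measure \<Rightarrow> real \<Rightarrow> complex" where
  "fourier_transform M \<xi> =
    (CLINT x|M. exp (- 2 * complex_of_real pi * \<i> * complex_of_real \<xi> * complex_of_real x))"

(* Borel probability measures on the line are the measures satisfying real_distribution.
   The supremum is taken in the reals; the set is contained in [0,1] and contains 0.
   At \<xi> = 0 the value of powr (always 0) has no influence on boundedness. *)
definition fourier_dim_measure :: "real measure \<Rightarrow> real" where
  "fourier_dim_measure M =
    Sup {s \<in> {0..1}. bounded (range (\<lambda>\<xi>. cmod (fourier_transform M \<xi>) * \<bar>\<xi>\<bar> powr (s / 2)))}"

(* The real supremum of the empty set is a junk value, hence the case distinction; for nonempty F
   there is a Dirac measure on F. *)
definition fourier_dim :: "real set \<Rightarrow> real" where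
  "fourier_dim F =
    (if F = {} then 0
     else Sup {fourier_dim_measure M | M. real_distribution M \<and> measure M F = 1})"

definition C_m :: "nat \<Rightarrow> (real \<Rightarrow> real) \<Rightarrow> bool" where
  "C_m m f \<longleftrightarrow>
    (\<forall>k<m. (deriv ^^ k) f differentiable_on UNIV) \<and> continuous_on UNIV ((deriv ^^ m) f)"

definition C_m_diffeomorphism :: "nat \<Rightarrow> (real \<Rightarrow> real) \<Rightarrow> bool" where
  "C_m_diffeomorphism m f \<longleftrightarrow> bij f \<and> C_m m f \<and> C_m m (inv f)"

end

theory Submission
  imports Defs "HOL-Computational_Algebra.Polynomial"
begin

text \<open>
  Let \<open>\<mu>\<close> be the Riesz product \<open>\<Prod>\<^sub>j (1 + cos (2\<pi> 256\<^sup>j x)) dx\<close> on the unit interval. Under \<open>\<mu>\<close> the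
  functions \<open>cos (2\<pi> 256\<^sup>j x)\<close> have mean 1/2 and are pairwise uncorrelated, so along a subsequence
  their averages converge to 1/2 on a set \<open>F\<close> of full \<open>\<mu>\<close>-measure. If the Fourier transform of a
  measure has power decay, the integrals of the same averages tend to 0, so by dominated convergence
  such a measure cannot live on \<open>F\<close>: the Fourier dimension of \<open>F\<close> is 0.

  The map \<open>f x = x + exp x\<close> is a smooth diffeomorphism with \<open>f'' > 0\<close>. By van der Corput's
  lemma, each term \<open>\<integral> exp (2\<pi>i (k x - \<xi> f x)) dx\<close> of the expanded Riesz product is
  \<open>O(|\<xi>|\<^sup>-\<^sup>1\<^sup>/\<^sup>2)\<close> uniformly in \<open>k\<close>, and also \<open>O(|k|\<^sup>-\<^sup>1\<^sup>/\<^sup>2)\<close>. There are so few terms at each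
  frequency scale that the image of \<open>\<mu>\<close> under \<open>f\<close> has Fourier transform \<open>O(|\<xi>|\<^sup>-\<^sup>1\<^sup>/\<^sup>4)\<close>; hence
  \<open>f(F)\<close> has Fourier dimension at least 1/2.
\<close>

section \<open>Oscillatory integrals\<close>

text \<open>Integration by parts: \<open>cis p\<close> is the derivative of
  \<open>cis p / (i p')\<close> up to an error of modulus \<open>p'' / p'^2\<close>. As
  \<open>p'' >= 0\<close>, this modulus is the derivative of \<open>- 1 / p'\<close>, so its
  integral is again a boundary term. The endpoint terms total at most \<open>2 / \<delta>\<close>,
  and so does the error.\<close>

lemma oscillatory_integral_first_derivative:
  fixes p p' p'' :: "real \<Rightarrow> real"
  assumes p: "\<And>x. (p has_real_derivative p' x) (at x)"
    and p': "\<And>x. (p' has_real_derivative p'' x) (at x)"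
    and "continuous_on UNIV p''"
    and convex: "\<And>x. p'' x \<ge> 0"
    and "\<delta> > 0" and large: "\<And>x. x \<in> {a..b} \<Longrightarrow> \<bar>p' x\<bar> \<ge> \<delta>"
  shows "norm (integral {a..b} (\<lambda>x. cis (p x))) \<le> 4 / \<delta>"
proof (cases "a \<le> b")
  case False
  then show ?thesis using \<open>\<delta> > 0\<close> by simp
next
  case True
  define F where "F x = cis (p x) * complex_of_real (1 / p' x)" for x
  define G where "G x = cis (p x) * complex_of_real (p'' x / (p' x)\<^sup>2)" for x
  have nz: "p' x \<noteq> 0" if "x \<in> {a..b}" for x
    using large[OF that] \<open>\<delta> > 0\<close> by auto
  have cont: "continuous_on S p" "continuous_on S p'" "continuous_on S p''" for S
    using p p' continuous_on_subset[OF assms(3) subset_UNIV]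
    by (auto intro: DERIV_continuous_on has_field_derivative_at_within)
  have dinv: "((\<lambda>x. 1 / p' x) has_real_derivative - (p'' x / (p' x)\<^sup>2)) (at x within {a..b})" if "x \<in> {a..b}" for x
    using nz[OF that] by (auto intro!: derivative_eq_intros has_field_derivative_at_within[OF p'] simp: power2_eq_square)
  have dcis: "((\<lambda>x. cis (p x)) has_vector_derivative (\<i> * cis (p x) * p' x)) (at x within {a..b})" for x
    using has_derivative_cis[OF has_field_derivative_at_within[OF p, unfolded has_field_derivative_def]]
    by (simp add: has_vector_derivative_def scaleR_conv_of_real mult_ac)
  have dF: "(F has_vector_derivative (\<i> * cis (p x) - G x)) (at x within {a..b})" if "x \<in> {a..b}" for x
    using has_vector_derivative_mult[OF dcis[of x] has_vector_derivative_of_real[OF dinv[OF that]]] nz[OF that]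
    by (simp add: F_def[abs_def] G_def)
  have FF: "((\<lambda>x. \<i> * cis (p x) - G x) has_integral (F b - F a)) {a..b}"
    by (rule fundamental_theorem_of_calculus[OF True dF])
  have inv: "((\<lambda>x. p'' x / (p' x)\<^sup>2) has_integral (1 / p' a - 1 / p' b)) {a..b}"
    using fundamental_theorem_of_calculus[OF True, of "\<lambda>x. - (1 / p' x)" "\<lambda>x. p'' x / (p' x)\<^sup>2"]
      DERIV_minus[OF dinv] by (auto simp: has_real_derivative_iff_has_vector_derivative)
  have cG: "continuous_on {a..b} G"
    unfolding G_def using nz by (auto intro!: continuous_intros cont)
  have "norm (integral {a..b} G) \<le> integral {a..b} (\<lambda>x. p'' x / (p' x)\<^sup>2)"
    using cG inv convex
    by (intro integral_norm_bound_integral) (auto simp: G_def norm_mult norm_divide norm_power intro: integrable_continuous_real)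
  also have "\<dots> = 1 / p' a - 1 / p' b"
    using inv by blast
  finally have iG: "norm (integral {a..b} G) \<le> 1 / p' a - 1 / p' b" .
  have "\<i> * integral {a..b} (\<lambda>x. cis (p x)) - integral {a..b} G = F b - F a"
    using integral_unique[OF FF] cG
    by (subst (asm) integral_diff) (auto intro!: integrable_continuous_real continuous_intros cont)
  then have "\<i> * integral {a..b} (\<lambda>x. cis (p x)) = F b - F a + integral {a..b} G"
    by (simp add: algebra_simps)
  then have "norm (integral {a..b} (\<lambda>x. cis (p x))) = norm (F b - F a + integral {a..b} G)"
    by (metis norm_mult norm_ii mult_1)
  also have "\<dots> \<le> norm (F b) + norm (F a) + norm (integral {a..b} G)"
    by (intro order_trans[OF norm_triangle_ineq] add_mono norm_triangle_ineq4 order_refl)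
  also have "\<dots> \<le> norm (F b) + norm (F a) + (1 / p' a - 1 / p' b)"
    using iG by simp
  also have "\<dots> \<le> 1 / \<delta> + 1 / \<delta> + (1 / \<delta> + 1 / \<delta>)"
  proof -
    have "1 / \<bar>p' x\<bar> \<le> 1 / \<delta> \<and> 1 / p' x \<le> 1 / \<bar>p' x\<bar> \<and> - (1 / p' x) \<le> 1 / \<bar>p' x\<bar>"
      if "x \<in> {a..b}" for x
      using large[OF that] \<open>\<delta> > 0\<close> nz[OF that] by (auto simp: frac_le abs_if)
    from this[of a] this[of b] show ?thesis
      using True by (simp add: F_def norm_mult norm_divide)
  qed
  finally show ?thesis by simp
qed

lemma norm_integral_cis_le:
  fixes p :: "real \<Rightarrow> real"
  assumes "a \<le> b" "continuous_on {a..b} p"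
  shows "norm (integral {a..b} (\<lambda>x. cis (p x))) \<le> b - a"
  using integral_bound[OF assms(1), of "\<lambda>x. cis (p x)" 1] assms(2)
  by (auto intro!: continuous_intros)

text \<open>On an initial stretch of length \<open>1 / sqrt \<kappa>\<close> the trivial bound is
  used. Beyond it \<open>p' x >= \<kappa> (x - a) >= sqrt \<kappa>\<close>, so the first-derivative
  bound contributes \<open>4 / sqrt \<kappa>\<close>. The chosen length balances the two
  contributions.\<close>

lemma oscillatory_integral_second_derivative_aux:
  fixes p p' p'' :: "real \<Rightarrow> real"
  assumes p: "\<And>x. (p has_real_derivative p' x) (at x)"
    and p': "\<And>x. (p' has_real_derivative p'' x) (at x)"
    and p'': "continuous_on UNIV p''"
    and nonneg: "\<And>x. p'' x \<ge> 0"
    and "\<kappa> > 0" and convex: "\<And>x. x \<in> {a..b} \<Longrightarrow> p'' x \<ge> \<kappa>"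
    and "p' a \<ge> 0"
  shows "norm (integral {a..b} (\<lambda>x. cis (p x))) \<le> 5 / sqrt \<kappa>"
proof (cases "b - a \<le> 1 / sqrt \<kappa>")
  case True
  have "continuous_on S p" for S
    using p by (auto intro: DERIV_continuous_on has_field_derivative_at_within)
  then have "norm (integral {a..b} (\<lambda>x. cis (p x))) \<le> max 0 (b - a)"
    using norm_integral_cis_le[of a b p] by (cases "a \<le> b") auto
  also have "\<dots> \<le> 5 / sqrt \<kappa>"
    using True \<open>\<kappa> > 0\<close> by (simp add: field_simps)
  finally show ?thesis .
next
  case False
  define c where "c = a + 1 / sqrt \<kappa>"
  have c: "a \<le> c" "c \<le> b" "c - a = 1 / sqrt \<kappa>"
    using False \<open>\<kappa> > 0\<close> by (auto simp: c_def)
  have cont: "continuous_on S p" for S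
    using p by (auto intro: DERIV_continuous_on has_field_derivative_at_within)
  have "\<bar>p' x\<bar> \<ge> sqrt \<kappa>" if "x \<in> {c..b}" for x
  proof -
    have "p' a - \<kappa> * a \<le> p' x - \<kappa> * x"
    proof (rule DERIV_nonneg_imp_nondecreasing[where f = "\<lambda>x. p' x - \<kappa> * x"])
      show "a \<le> x" using that c by auto
      fix y assume "a \<le> y" "y \<le> x"
      then have "p'' y - \<kappa> \<ge> 0" using convex[of y] that by auto
      moreover have "((\<lambda>x. p' x - \<kappa> * x) has_real_derivative p'' y - \<kappa>) (at y)"
        by (auto intro!: derivative_eq_intros p')
      ultimately show "\<exists>d. ((\<lambda>x. p' x - \<kappa> * x) has_real_derivative d) (at y) \<and> 0 \<le> d"
        by blast
    qed
    then have "p' x \<ge> \<kappa> * (x - a)"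
      using \<open>p' a \<ge> 0\<close> by (simp add: algebra_simps)
    moreover have "\<kappa> * (x - a) \<ge> \<kappa> * (1 / sqrt \<kappa>)"
      using that c(3) \<open>\<kappa> > 0\<close> by (intro mult_left_mono) auto
    moreover have "\<kappa> * (1 / sqrt \<kappa>) = sqrt \<kappa>"
      using \<open>\<kappa> > 0\<close> by (simp add: real_div_sqrt)
    ultimately show ?thesis by linarith
  qed
  then have right: "norm (integral {c..b} (\<lambda>x. cis (p x))) \<le> 4 / sqrt \<kappa>"
    using p p' p'' nonneg \<open>\<kappa> > 0\<close> by (intro oscillatory_integral_first_derivative[of p p' p'']) auto
  have left: "norm (integral {a..c} (\<lambda>x. cis (p x))) \<le> 1 / sqrt \<kappa>"
    using norm_integral_cis_le[OF c(1) cont] c(3) by simp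
  have "integral {a..b} (\<lambda>x. cis (p x)) =
      integral {a..c} (\<lambda>x. cis (p x)) + integral {c..b} (\<lambda>x. cis (p x))"
    using c cont
    by (intro Henstock_Kurzweil_Integration.integral_combine[symmetric] integrable_continuous_real continuous_intros)
  then show ?thesis
    using left right norm_triangle_ineq[of "integral {a..c} (\<lambda>x. cis (p x))" "integral {c..b} (\<lambda>x. cis (p x))"]
    by (simp add: field_simps)
qed

text \<open>Van der Corput's second-derivative test. When \<open>p'\<close> changes sign between the
  endpoints, the interval is cut at a zero of \<open>p'\<close>, and each side costs
  \<open>5 / sqrt \<kappa>\<close>.\<close>

lemma oscillatory_integral_second_derivative:
  fixes p p' p'' :: "real \<Rightarrow> real"
  assumes p: "\<And>x. (p has_real_derivative p' x) (at x)"
    and p': "\<And>x. (p' has_real_derivative p'' x) (at x)"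
    and p'': "continuous_on UNIV p''"
    and nonneg: "\<And>x. p'' x \<ge> 0"
    and "\<kappa> > 0" and convex: "\<And>x. x \<in> {a..b} \<Longrightarrow> p'' x \<ge> \<kappa>"
  shows "norm (integral {a..b} (\<lambda>x. cis (p x))) \<le> 10 / sqrt \<kappa>"
proof -
  have right: "norm (integral {c..d} (\<lambda>x. cis (p x))) \<le> 5 / sqrt \<kappa>"
    if "p' c \<ge> 0" "a \<le> c" "d \<le> b" for c d
    using assms that by (intro oscillatory_integral_second_derivative_aux[of p p' p'']) auto
  have left: "norm (integral {c..d} (\<lambda>x. cis (p x))) \<le> 5 / sqrt \<kappa>"
    if "p' d \<le> 0" "a \<le> c" "d \<le> b" for c d
  proof -
    \<comment> \<open>Reflection preserves the second derivative and turns \<open>p' d <= 0\<close>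
      into a nonnegative first derivative at the left endpoint \<open>- d\<close>.\<close>
    have "norm (integral {-d..-c} (\<lambda>x. cis (p (- x)))) \<le> 5 / sqrt \<kappa>"
    proof (rule oscillatory_integral_second_derivative_aux[where p' = "\<lambda>x. - p' (- x)" and p'' = "\<lambda>x. p'' (- x)"])
      show "((\<lambda>x. p (- x)) has_real_derivative - p' (- x)) (at x)" for x
        using DERIV_chain2[OF p DERIV_minus[OF DERIV_ident], of x] by simp
      show "((\<lambda>x. - p' (- x)) has_real_derivative p'' (- x)) (at x)" for x
        using DERIV_minus[OF DERIV_chain2[OF p' DERIV_minus[OF DERIV_ident], of x]] by simp
      show "continuous_on UNIV (\<lambda>x. p'' (- x))"
        by (rule continuous_on_compose2[OF p'' continuous_on_minus[OF continuous_on_id]]) simp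
    qed (use assms that in auto)
    then show ?thesis
      by (simp add: Henstock_Kurzweil_Integration.integral_reflect_real[where f = "\<lambda>x. cis (p x)"])
  qed
  have "5 / sqrt \<kappa> \<le> 10 / sqrt \<kappa>"
    using \<open>\<kappa> > 0\<close> by (simp add: field_simps)
  consider "a > b" | "p' a \<ge> 0" | "p' b \<le> 0" | "a \<le> b" "p' a \<le> 0" "0 \<le> p' b"
    by linarith
  then show ?thesis
  proof cases
    case 1
    then show ?thesis using \<open>\<kappa> > 0\<close> by simp
  next
    case 2
    then show ?thesis using right[of a b] \<open>5 / sqrt \<kappa> \<le> _\<close> by linarith
  next
    case 3
    then show ?thesis using left[of b a] \<open>5 / sqrt \<kappa> \<le> _\<close> by linarith
  next
    case 4
    have "continuous_on S p" "continuous_on S p'" for S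
      using p p' by (auto intro: DERIV_continuous_on has_field_derivative_at_within)
    then obtain c where c: "a \<le> c" "c \<le> b" "p' c = 0"
      using IVT'[of p' a 0 b] 4 by auto
    have "integral {a..b} (\<lambda>x. cis (p x)) =
        integral {a..c} (\<lambda>x. cis (p x)) + integral {c..b} (\<lambda>x. cis (p x))"
      using c \<open>continuous_on _ p\<close>
      by (intro Henstock_Kurzweil_Integration.integral_combine[symmetric] integrable_continuous_real continuous_intros)
    then show ?thesis
      using left[of c a] right[of c b] c
        norm_triangle_ineq[of "integral {a..c} (\<lambda>x. cis (p x))" "integral {c..b} (\<lambda>x. cis (p x))"]
      by (simp add: field_simps)
  qed
qed

section \<open>The diffeomorphism\<close>

text \<open>The summand \<open>exp x\<close> has a second derivative bounded below on
  \<open>{0..1}\<close>; the summand \<open>x\<close> keeps the first derivative above 1, which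
  makes the map onto and its inverse smooth.\<close>

definition expand :: "real \<Rightarrow> real" where "expand x = x + exp x"

lemma DERIV_expand: "(expand has_real_derivative 1 + exp x) (at x)"
  unfolding expand_def[abs_def] by (auto intro!: derivative_eq_intros)

lemma strict_mono_expand: "strict_mono expand"
  by (auto simp: strict_mono_def expand_def intro!: add_strict_mono)

lemma bij_expand: "bij expand"
  unfolding bij_def
proof
  show "inj expand"
    by (rule strict_mono_imp_inj_on[OF strict_mono_expand])
  have "\<exists>x. expand x = y" for y
  proof -
    \<comment> \<open>Either the point is \<open>y - 1\<close>, where \<open>exp\<close> is at most
      1, or it is 0 and \<open>expand 0 = 1 \<le> y\<close>.\<close>
    have "expand (min (y - 1) 0) \<le> y"
    proof -
      have "exp (min (y - 1) 0) \<le> 1" by simp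
      then show ?thesis by (simp add: expand_def min_def split: if_splits)
    qed
    moreover have "y \<le> expand y"
      by (simp add: expand_def)
    moreover have "continuous_on {min (y - 1) 0..y} expand"
      by (auto intro!: DERIV_continuous_on has_field_derivative_at_within[OF DERIV_expand])
    moreover have "min (y - 1) 0 \<le> y" by linarith
    ultimately show ?thesis
      using IVT'[of expand "min (y - 1) 0" y y] by blast
  qed
  then show "surj expand" by (metis surjI)
qed

lemma C_mI:
  assumes "\<And>k x. ((deriv ^^ k) f has_real_derivative (deriv ^^ Suc k) f x) (at x)"
  shows "C_m m f"
  unfolding C_m_def differentiable_on_def
  using assms DERIV_continuous_on[OF assms] by (auto simp: real_differentiable_def)

lemma C_m_expand: "C_m m expand"
proof (rule C_mI)
  fix k x
  have 1: "deriv expand = (\<lambda>x. 1 + exp x)"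
    by (intro ext DERIV_imp_deriv DERIV_expand)
  have "((\<lambda>x. 1 + exp x) has_real_derivative exp x) (at x)" for x :: real
    by (auto intro!: derivative_eq_intros)
  then have "deriv (\<lambda>x::real. 1 + exp x) = exp" "deriv exp = (exp :: real \<Rightarrow> real)"
    by (intro ext DERIV_imp_deriv DERIV_exp; simp)+
  then have 2: "(deriv ^^ Suc (Suc k)) expand = exp" for k
    by (induction k) (simp_all add: 1)
  show "((deriv ^^ k) expand has_real_derivative (deriv ^^ Suc k) expand x) (at x)"
  proof (cases k)
    case 0
    then show ?thesis using DERIV_expand by (simp add: 1)
  next
    case (Suc j)
    show ?thesis
    proof (cases j)
      case 0
      have "((\<lambda>x. 1 + exp x) has_real_derivative exp x) (at x)"
        by (auto intro!: derivative_eq_intros)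
      then show ?thesis using 2[of 0] Suc 0 by (simp add: 1)
    next
      case (Suc i)
      then show ?thesis using 2[of i] 2[of j] \<open>k = Suc j\<close> by (simp del: funpow.simps add: DERIV_exp)
    qed
  qed
qed

text \<open>All derivatives of \<open>g\<close> are polynomials in \<open>u = g'\<close>.\<close>

lemma C_m_of_autonomous_ode:
  fixes g u :: "real \<Rightarrow> real"
  assumes g: "\<And>x. (g has_real_derivative u x) (at x)"
    and u: "\<And>x. (u has_real_derivative poly Q (u x)) (at x)"
  shows "C_m m g"
proof -
  have deriv_u: "((\<lambda>x. poly P (u x)) has_real_derivative poly (pderiv P * Q) (u x)) (at x)" for P x
    using DERIV_chain2[OF poly_DERIV u] by simp
  have poly: "\<exists>P. (deriv ^^ Suc k) g = (\<lambda>x. poly P (u x))" for k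
  proof (induction k)
    case 0
    have "deriv g = (\<lambda>x. poly [:0, 1:] (u x))"
      using g by (auto intro: DERIV_imp_deriv)
    then have "(deriv ^^ Suc 0) g = (\<lambda>x. poly [:0, 1:] (u x))" by simp
    then show ?case by blast
  next
    case (Suc k)
    then obtain P where "(deriv ^^ Suc k) g = (\<lambda>x. poly P (u x))" by blast
    moreover have "deriv (\<lambda>x. poly P (u x)) = (\<lambda>x. poly (pderiv P * Q) (u x))"
      using deriv_u by (auto intro: DERIV_imp_deriv)
    ultimately have "(deriv ^^ Suc (Suc k)) g = (\<lambda>x. poly (pderiv P * Q) (u x))"
      by simp
    then show ?case by blast
  qed
  have "((deriv ^^ Suc k) g has_real_derivative (deriv ^^ Suc (Suc k)) g x) (at x)" for k x
  proof -
    obtain P where P: "(deriv ^^ Suc k) g = (\<lambda>x. poly P (u x))" using poly by blast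
    then show ?thesis
      using deriv_u[of P x] DERIV_imp_deriv[OF deriv_u[of P x]] by (simp add: P del: poly_mult)
  qed
  moreover have "deriv g x = u x" for x
    using g by (rule DERIV_imp_deriv)
  ultimately have "((deriv ^^ k) g has_real_derivative (deriv ^^ Suc k) g x) (at x)" for k x
    using g by (cases k) auto
  then show ?thesis by (rule C_mI)
qed

lemma expand_inv: "expand (inv expand y) = y"
  using bij_expand by (simp add: bij_is_surj surj_f_inv_f)

text \<open>With \<open>g\<close> the inverse and \<open>u = 1 / (1 + exp g)\<close> its derivative,
  \<open>exp g * u = 1 - u\<close>. Hence \<open>u' = - u^2 (1 - u) = u^3 - u^2\<close>, a
  polynomial in \<open>u\<close>.\<close>

lemma C_m_inv_expand: "C_m m (inv expand)"
proof (rule C_m_of_autonomous_ode)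
  let ?g = "inv expand"
  let ?u = "\<lambda>y. inverse (1 + exp (?g y))"
  have cont: "isCont ?g y" for y
  proof -
    have "isCont expand x" for x
      using DERIV_expand by (rule DERIV_isCont)
    then have "isCont ?g (expand (?g y))"
      by (intro isCont_inverse_function[of 1 _ ?g expand])
         (simp_all add: inv_f_f[OF bij_is_inj[OF bij_expand]])
    then show ?thesis unfolding expand_inv .
  qed
  have nz: "1 + exp (?g y) \<noteq> 0" for y
    using exp_gt_zero[of "?g y"] by linarith
  show g: "(?g has_real_derivative ?u y) (at y)" for y
  proof (rule DERIV_inverse_function)
    show "(expand has_real_derivative 1 + exp (?g y)) (at (?g y))" by (rule DERIV_expand)
    show "y - 1 < y" "y < y + 1" by auto
  qed (rule nz expand_inv cont)+
  show "(?u has_real_derivative poly [:0, 0, -1, 1:] (?u y)) (at y)" for y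
  proof -
    have "((\<lambda>y. 1 + exp (?g y)) has_real_derivative exp (?g y) * ?u y) (at y)"
      using DERIV_add[OF DERIV_const DERIV_fun_exp[OF g]] by simp
    from DERIV_inverse'[OF this nz] show ?thesis
      
    proof (rule DERIV_cong)
      have "(1 + exp (?g y)) * ?u y = 1"
        using nz by (rule right_inverse)
      then have exp_u: "exp (?g y) * ?u y = 1 - ?u y"
        by (simp add: distrib_right)
      show "- (?u y * (exp (?g y) * ?u y) * ?u y) = poly [:0, 0, -1, 1:] (?u y)"
        unfolding exp_u by (simp add: algebra_simps)
    qed
  qed
qed

section \<open>Oscillatory integrals with phase \<open>k x - \<xi> expand x\<close>\<close>

lemma norm_integral_cis_minus:
  "norm (integral S (\<lambda>x. cis (- p x))) = norm (integral S (\<lambda>x. cis (p x)))"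
  using Henstock_Kurzweil_Integration.integral_cnj[of S "\<lambda>x. cis (p x)"]
  unfolding cis_cnj by (metis complex_mod_cnj)

text \<open>The tests above ask for a convex phase. For \<open>\<xi> \<ge> 0\<close> complex
  conjugation supplies one, with \<open>l = k\<close>; for negative \<open>\<xi>\<close> the phase
  is convex already, with \<open>l = - k\<close>.\<close>

lemma norm_expand_integral_abs:
  obtains l where "\<bar>l\<bar> = \<bar>k\<bar>"
    "norm (integral {0..1} (\<lambda>x. cis (2 * pi * (k * x - \<xi> * expand x)))) =
     norm (integral {0..1} (\<lambda>x. cis (2 * pi * (\<bar>\<xi>\<bar> * expand x - l * x))))"
proof (cases "\<xi> \<ge> 0")
  case True
  have "(\<lambda>x. cis (- (2 * pi * (\<xi> * expand x - k * x)))) = (\<lambda>x. cis (2 * pi * (k * x - \<xi> * expand x)))"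
    by (simp add: algebra_simps)
  then show ?thesis
    using that[of k] norm_integral_cis_minus[of "{0..1}" "\<lambda>x. 2 * pi * (\<xi> * expand x - k * x)"] True
    by simp
next
  case False
  then show ?thesis
    using that[of "- k"] by (simp add: add.commute)
qed

text \<open>The linear term \<open>k x\<close> vanishes from the second derivative of the phase,
  whose modulus is at least \<open>|\<xi>|\<close> on \<open>{0..1}\<close>; so the bound is uniform
  in \<open>k\<close>.\<close>

lemma expand_integral_le_frequency:
  assumes "\<xi> \<noteq> 0"
  shows "norm (integral {0..1} (\<lambda>x. cis (2 * pi * (k * x - \<xi> * expand x)))) \<le> 10 / sqrt \<bar>\<xi>\<bar>"
proof -
  have pos: "norm (integral {0..1} (\<lambda>x. cis (2 * pi * (\<eta> * expand x - l * x)))) \<le> 10 / sqrt \<eta>"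
    if "\<eta> > 0" for \<eta> l
  proof (rule oscillatory_integral_second_derivative[where p' = "\<lambda>x. 2 * pi * (\<eta> * (1 + exp x) - l)"
        and p'' = "\<lambda>x. 2 * pi * (\<eta> * exp x)"])
    show "((\<lambda>x. 2 * pi * (\<eta> * expand x - l * x)) has_real_derivative 2 * pi * (\<eta> * (1 + exp x) - l)) (at x)" for x
      by (auto intro!: derivative_eq_intros DERIV_expand)
    show "((\<lambda>x. 2 * pi * (\<eta> * (1 + exp x) - l)) has_real_derivative 2 * pi * (\<eta> * exp x)) (at x)" for x
      by (auto intro!: derivative_eq_intros)
    show "\<eta> \<le> 2 * pi * (\<eta> * exp x)" if "x \<in> {0..1}" for x
    proof -
      have "1 * \<eta> \<le> (2 * pi * exp x) * \<eta>"
        using that \<open>\<eta> > 0\<close> pi_gt3 mult_mono[of 1 "2 * pi" 1 "exp x"]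
        by (intro mult_right_mono) auto
      then show ?thesis by (simp add: mult_ac)
    qed
  qed (use that in \<open>auto intro!: continuous_intros\<close>)
  show ?thesis
    by (rule norm_expand_integral_abs[of k \<xi>]) (use pos[of "\<bar>\<xi>\<bar>"] assms in simp)
qed

text \<open>Two regimes. If \<open>|k| \<le> 8 |\<xi>|\<close>, the bound in terms of
  \<open>\<xi>\<close> already suffices. Otherwise the linear term dominates the derivative of the
  phase, and the first-derivative test gives even \<open>4 / |k|\<close>.\<close>

lemma expand_integral_le_shift:
  assumes "\<bar>\<xi>\<bar> \<ge> 1" "\<bar>k\<bar> \<ge> 1"
  shows "norm (integral {0..1} (\<lambda>x. cis (2 * pi * (k * x - \<xi> * expand x)))) \<le> 40 / sqrt \<bar>k\<bar>"
proof (cases "\<bar>k\<bar> \<le> 8 * \<bar>\<xi>\<bar>")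
  case True
  have "sqrt \<bar>k\<bar> \<le> sqrt (16 * \<bar>\<xi>\<bar>)"
    using True by (intro real_sqrt_le_mono) auto
  then have "sqrt \<bar>k\<bar> \<le> 4 * sqrt \<bar>\<xi>\<bar>"
    by (simp add: real_sqrt_mult)
  then have "10 / sqrt \<bar>\<xi>\<bar> \<le> 40 / sqrt \<bar>k\<bar>"
    using assms by (simp add: field_simps)
  moreover have "\<xi> \<noteq> 0" using assms by auto
  ultimately show ?thesis
    using expand_integral_le_frequency[of \<xi> k] by linarith
next
  case False
  \<comment> \<open>On \<open>{0..1}\<close> the derivative of \<open>expand\<close> is at most 4,
    so by the factor 8 it cancels at most half of \<open>|l|\<close>; the factor
    \<open>2 * pi\<close> makes up for that half.\<close>
  have deriv_large: "\<bar>2 * pi * (\<eta> * (1 + exp x) - l)\<bar> \<ge> \<bar>l\<bar>"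
    if "x \<in> {0..1}" "\<bar>l\<bar> > 8 * \<bar>\<eta>\<bar>" for l \<eta> x :: real
  proof -
    have "exp x \<le> exp 1" using that by simp
    then have "1 + exp x \<le> 4" using exp_le by linarith
    then have "\<bar>\<eta> * (1 + exp x)\<bar> \<le> \<bar>\<eta>\<bar> * 4"
      by (simp add: abs_mult add_pos_pos mult_left_mono)
    then have "\<bar>\<eta> * (1 + exp x) - l\<bar> \<ge> \<bar>l\<bar> / 2" using that by linarith
    moreover have "\<bar>l\<bar> / 2 * 2 \<le> \<bar>\<eta> * (1 + exp x) - l\<bar> * (2 * pi)"
      using calculation pi_gt3 by (intro mult_mono) auto
    moreover have "\<bar>2 * pi * z\<bar> = \<bar>z\<bar> * (2 * pi)" for z
      by (simp add: abs_mult)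
    ultimately show ?thesis by simp
  qed
  have pos: "norm (integral {0..1} (\<lambda>x. cis (2 * pi * (\<eta> * expand x - l * x)))) \<le> 4 / \<bar>l\<bar>"
    if "\<eta> > 0" "\<bar>l\<bar> > 8 * \<bar>\<eta>\<bar>" for \<eta> l
  proof (rule oscillatory_integral_first_derivative[where p' = "\<lambda>x. 2 * pi * (\<eta> * (1 + exp x) - l)"
        and p'' = "\<lambda>x. 2 * pi * (\<eta> * exp x)"])
    show "((\<lambda>x. 2 * pi * (\<eta> * expand x - l * x)) has_real_derivative 2 * pi * (\<eta> * (1 + exp x) - l)) (at x)" for x
      by (auto intro!: derivative_eq_intros DERIV_expand)
    show "((\<lambda>x. 2 * pi * (\<eta> * (1 + exp x) - l)) has_real_derivative 2 * pi * (\<eta> * exp x)) (at x)" for x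
      by (auto intro!: derivative_eq_intros)
    show "\<bar>l\<bar> \<le> \<bar>2 * pi * (\<eta> * (1 + exp x) - l)\<bar>" if "x \<in> {0..1}" for x
      by (rule deriv_large[OF that \<open>\<bar>l\<bar> > _\<close>])
  qed (use that in \<open>auto intro!: continuous_intros\<close>)
  have "norm (integral {0..1} (\<lambda>x. cis (2 * pi * (k * x - \<xi> * expand x)))) \<le> 4 / \<bar>k\<bar>"
  proof (rule norm_expand_integral_abs[of k \<xi>])
    fix l assume "\<bar>l\<bar> = \<bar>k\<bar>" and
      "norm (integral {0..1} (\<lambda>x. cis (2 * pi * (k * x - \<xi> * expand x)))) =
       norm (integral {0..1} (\<lambda>x. cis (2 * pi * (\<bar>\<xi>\<bar> * expand x - l * x))))"
    then show ?thesis using pos[of "\<bar>\<xi>\<bar>" l] assms False by auto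
  qed
  also have "4 / \<bar>k\<bar> \<le> 40 / sqrt \<bar>k\<bar>"
  proof -
    have "sqrt \<bar>k\<bar> \<le> \<bar>k\<bar>" using assms self_le_power[of "\<bar>k\<bar>" 2] by (intro real_le_lsqrt) auto
    then show ?thesis using assms by (intro frac_le) auto
  qed
  finally show ?thesis .
qed

text \<open>The geometric mean of the two preceding bounds.\<close>

lemma expand_integral_le:
  assumes "\<bar>\<xi>\<bar> \<ge> 1" "\<bar>k\<bar> \<ge> 1" "c > 0" "c ^ 4 \<le> \<bar>k\<bar>"
  shows "norm (integral {0..1} (\<lambda>x. cis (2 * pi * (k * x - \<xi> * expand x)))) \<le> 20 / (\<bar>\<xi>\<bar> powr (1/4) * c)"
    (is "?N \<le> _")
proof -
  define a where "a = \<bar>\<xi>\<bar> powr (1/4)"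
  have "a > 0" using assms by (simp add: a_def)
  have "a\<^sup>2 = \<bar>\<xi>\<bar> powr (1/2)"
    by (simp add: a_def powr_powr flip: powr_numeral)
  then have a: "a\<^sup>2 = sqrt \<bar>\<xi>\<bar>"
    using assms by (simp add: powr_half_sqrt)
  have "sqrt (c ^ 4) \<le> sqrt \<bar>k\<bar>"
    using assms by simp
  moreover have "sqrt (c ^ 4) = c\<^sup>2"
    using real_sqrt_abs[of "c\<^sup>2"] by (simp flip: power_mult)
  ultimately have c: "c\<^sup>2 \<le> sqrt \<bar>k\<bar>" by simp
  have "?N \<le> 10 / a\<^sup>2"
    using expand_integral_le_frequency[of \<xi> k] assms by (simp add: a)
  moreover have "40 / sqrt \<bar>k\<bar> \<le> 40 / c\<^sup>2"
    using c assms by (intro divide_left_mono) auto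
  then have "?N \<le> 40 / c\<^sup>2"
    using expand_integral_le_shift[OF assms(1,2)] by linarith
  ultimately have "?N * ?N \<le> (10 / a\<^sup>2) * (40 / c\<^sup>2)"
    by (intro mult_mono) auto
  also have "\<dots> = (20 / (a * c))\<^sup>2"
    by (simp add: power2_eq_square field_simps)
  finally show ?thesis
    unfolding a_def[symmetric] power2_eq_square[symmetric]
    using \<open>a > 0\<close> \<open>c > 0\<close> by (elim power2_le_imp_le) auto
qed

section \<open>Riesz products\<close>

text \<open>The ratio 256 makes \<open>2\<^sup>n\<close> (the total weight of the expansion) times \<open>(256\<^sup>n)\<^sup>-\<^sup>1\<^sup>/\<^sup>4\<close> summable in \<open>n\<close>.\<close>

definition riesz :: "nat \<Rightarrow> real \<Rightarrow> real" where
  "riesz n x = (\<Prod>j<n. 1 + cos (2 * pi * (256 ^ j * x)))"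

lemma riesz_nonneg: "riesz n x \<ge> 0"
  unfolding riesz_def by (intro prod_nonneg) (metis add.commute cos_ge_minus_one diff_ge_0_iff_ge diff_minus_eq_add)

lemma continuous_on_riesz [continuous_intros]: "continuous_on S (riesz n)"
  unfolding riesz_def[abs_def] by (intro continuous_intros)

text \<open>The weight \<open>h\<close> serves two uses: \<open>h = 1\<close> gives the Fourier
  coefficients of the Riesz product, \<open>h = cis (- 2 pi \<xi> expand)\<close> and
  \<open>k = 0\<close> the Fourier transform of its image at \<open>\<xi>\<close>.\<close>

definition riesz_integral :: "(real \<Rightarrow> complex) \<Rightarrow> nat \<Rightarrow> int \<Rightarrow> complex" where
  "riesz_integral h n k = (CLINT x:{0..1}|lborel. riesz n x * (cis (2 * pi * (k * x)) * h x))"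

text \<open>By Euler's formula the new factor splits into the frequency shifts 0,
  \<open>256 ^ n\<close> and \<open>- 256 ^ n\<close>, with weights 1, 1/2 and 1/2.\<close>

lemma riesz_integral_Suc:
  assumes "continuous_on {0..1} h"
  shows "riesz_integral h (Suc n) k =
    riesz_integral h n k + (riesz_integral h n (k + 256 ^ n) + riesz_integral h n (k - 256 ^ n)) / 2"
proof -
  define w where "w l x = riesz n x * (cis (2 * pi * (real_of_int l * x)) * h x)" for l x
  have int: "set_integrable lborel {0..1} (w l)" for l
    unfolding w_def[abs_def] using assms
    by (intro borel_integrable_atLeastAtMost' continuous_intros)
  have "complex_of_real (cos t) = (cis t + cis (- t)) / 2" for t
    by (simp add: complex_eq_iff)
  then have cos_cis: "complex_of_real (1 + cos t) * cis s = cis s + (cis (s + t) + cis (s - t)) / 2" for s t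
    by (simp add: algebra_simps cis_mult add_divide_distrib)
  have "riesz (Suc n) x * (cis (2 * pi * (k * x)) * h x) = w k x + (w (k + 256 ^ n) x + w (k - 256 ^ n) x) / 2" for x :: real
  proof -
    have "riesz (Suc n) x * (cis (2 * pi * (k * x)) * h x) =
        riesz n x * ((complex_of_real (1 + cos (2 * pi * (256 ^ n * x))) * cis (2 * pi * (k * x))) * h x)"
      by (simp add: riesz_def mult_ac)
    also have "\<dots> = w k x + (w (k + 256 ^ n) x + w (k - 256 ^ n) x) / 2"
      unfolding cos_cis w_def by (simp add: algebra_simps)
    finally show ?thesis .
  qed
  then show ?thesis
    unfolding riesz_integral_def w_def[symmetric] using int
    by (simp add: set_integral_add)
qed

lemma sum_256_power: "255 * (\<Sum>j<n. 256 ^ j) = (256 ^ n - 1 :: int)"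
  by (induction n) auto

text \<open>Each factor has total weight 2 and moves the frequency by at most
  \<open>256 ^ j\<close>. So the full expansion has weight \<open>2 ^ n\<close> and involves only
  frequencies covered by the hypothesis on \<open>B\<close>.\<close>

lemma norm_riesz_integral_le:
  assumes h: "continuous_on {0..1} h"
    and bound: "\<And>l. \<bar>k\<bar> - (\<Sum>j<n. 256 ^ j) \<le> \<bar>l\<bar> \<Longrightarrow> norm (riesz_integral h 0 l) \<le> B"
  shows "norm (riesz_integral h n k) \<le> 2 ^ n * B"
  using bound
proof (induction n arbitrary: k)
  case 0
  then show ?case by simp
next
  case (Suc n)
  let ?J = "riesz_integral h n"
  \<comment> \<open>The last factor spends \<open>256 ^ n\<close> of the permitted total shift,
    which leaves the sum over \<open>j < n\<close> for the induction hypothesis.\<close>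
  have *: "norm (?J l) \<le> 2 ^ n * B" if "\<bar>k\<bar> - 256 ^ n \<le> \<bar>l\<bar>" for l
  proof (rule Suc.IH)
    fix i assume "\<bar>l\<bar> - (\<Sum>j<n. 256 ^ j) \<le> \<bar>i\<bar>"
    then show "norm (riesz_integral h 0 i) \<le> B"
      using that by (intro Suc.prems) simp
  qed
  have J: "norm (?J k) \<le> 2 ^ n * B" "norm (?J (k + 256 ^ n)) \<le> 2 ^ n * B" "norm (?J (k - 256 ^ n)) \<le> 2 ^ n * B"
    using zero_less_power[of "256::int" n] by (intro *; linarith)+
  have "norm (?J k + (?J (k + 256 ^ n) + ?J (k - 256 ^ n)) / 2)
      \<le> norm (?J k) + (norm (?J (k + 256 ^ n)) + norm (?J (k - 256 ^ n))) / 2"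
    by (intro order_trans[OF norm_triangle_ineq] add_left_mono) (simp add: norm_divide norm_triangle_ineq)
  also have "\<dots> \<le> 2 ^ Suc n * B"
  proof -
    have "a + (b + d) / 2 \<le> 2 * c" if "a \<le> c" "b \<le> c" "d \<le> c" for a b c d :: real
    proof -
      have "(b + d) / 2 \<le> c" using that by simp
      then show ?thesis unfolding mult_2 using \<open>a \<le> c\<close> by (intro add_mono)
    qed
    from this[OF J] show ?thesis by (simp add: mult.assoc)
  qed
  finally show ?case
    by (simp add: riesz_integral_Suc[OF h])
qed

section \<open>Fourier coefficients of the finite Riesz products\<close>

abbreviation riesz_coeff :: "nat \<Rightarrow> int \<Rightarrow> complex" where
  "riesz_coeff \<equiv> riesz_integral (\<lambda>_. 1)"

lemma riesz_coeff_0: "riesz_coeff 0 k = (if k = 0 then 1 else 0)"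
proof (cases "k = 0")
  case True
  then show ?thesis
    by (simp add: riesz_integral_def riesz_def set_lebesgue_integral_def)
next
  case False
  have "riesz_coeff 0 k = (CLINT x:{0..1}|lborel. cis (2 * pi * (k * x)))"
    by (simp add: riesz_integral_def riesz_def)
  also have "\<dots> = integral {0..1} (\<lambda>x. cis (2 * pi * (k * x)))"
    by (intro set_borel_integral_eq_integral borel_integrable_atLeastAtMost' continuous_intros)
  also have "((\<lambda>x. cis (2 * pi * (k * x))) has_integral
      (cis (2 * pi * (real_of_int k * 1)) / (2 * pi * k * \<i>) - cis (2 * pi * (real_of_int k * 0)) / (2 * pi * k * \<i>))) {0..1}"
  proof (rule fundamental_theorem_of_calculus[where f = "\<lambda>x. cis (2 * pi * (k * x)) / (2 * pi * k * \<i>)"])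
    show "((\<lambda>x. cis (2 * pi * (k * x)) / (2 * pi * k * \<i>)) has_vector_derivative cis (2 * pi * (k * x)))
        (at x within {0..1})" for x :: real
      unfolding has_vector_derivative_def using False
      by (auto intro!: derivative_eq_intros simp: scaleR_conv_of_real field_simps)
  qed simp
  then have "integral {0..1} (\<lambda>x. cis (2 * pi * (k * x))) = 0"
    using cis_multiple_2pi[of "real_of_int k"] by (simp add: integral_unique)
  finally show ?thesis using False by simp
qed

text \<open>From so large a \<open>k\<close> the shifts cannot reach frequency 0, the only one with
  a nonzero integral; the preceding bound applies with \<open>B = 0\<close>.\<close>

lemma riesz_coeff_eq_0:
  assumes "\<bar>k\<bar> > (\<Sum>j<n. 256 ^ j)"
  shows "riesz_coeff n k = 0"
proof -
  have "norm (riesz_coeff n k) \<le> 2 ^ n * 0"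
    using assms by (intro norm_riesz_integral_le) (auto simp: riesz_coeff_0)
  then show ?thesis by simp
qed

text \<open>Lacunarity: each later factor, number \<open>N\<close>, shifts \<open>k\<close> to
  modulus above \<open>256 ^ N / 2\<close>, outside the spectrum of the first \<open>N\<close>
  factors, and so leaves the coefficient unchanged.\<close>

lemma riesz_coeff_stable:
  assumes "2 * \<bar>k\<bar> < 256 ^ n" "n \<le> N"
  shows "riesz_coeff N k = riesz_coeff n k"
  using \<open>n \<le> N\<close>
proof (induction N rule: dec_induct)
  case (step N)
  have "2 * \<bar>k\<bar> < 256 ^ N"
    using assms(1) power_increasing[OF step(1), of "256::int"] by linarith
  then have "\<bar>k + 256 ^ N\<bar> > (\<Sum>j<N. 256 ^ j)" "\<bar>k - 256 ^ N\<bar> > (\<Sum>j<N. 256 ^ j)"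
    using sum_256_power[of N] by linarith+
  then show ?case
    using step by (simp add: riesz_integral_Suc riesz_coeff_eq_0)
qed simp

lemma riesz_coeff_zero: "riesz_coeff N 0 = 1"
  using riesz_coeff_stable[of 0 0 N] by (simp add: riesz_coeff_0)

text \<open>Of the three frequencies that factor \<open>j\<close> links to \<open>l\<close>, only
  \<open>k\<close> lies in the spectrum of the first \<open>j\<close> factors, and its weight is
  1/2.\<close>

lemma riesz_coeff_peak:
  assumes "3 * \<bar>k\<bar> < 256 ^ j" "j < N" "l = k + 256 ^ j \<or> l = k - 256 ^ j"
  shows "riesz_coeff N l = riesz_coeff j k / 2"
proof -
  have *: "2 * \<bar>l\<bar> < 256 ^ Suc j" using assms by auto
  have "riesz_coeff N l = riesz_coeff (Suc j) l"
    using riesz_coeff_stable[OF *, of N] assms by simp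
  moreover have "\<bar>l\<bar> > (\<Sum>i<j. 256 ^ i)" "\<bar>k + 2 * 256 ^ j\<bar> > (\<Sum>i<j. 256 ^ i)" "\<bar>k - 2 * 256 ^ j\<bar> > (\<Sum>i<j. 256 ^ i)"
    using assms sum_256_power[of j] by linarith+
  ultimately show ?thesis
    using assms(3) by (auto simp: riesz_integral_Suc riesz_coeff_eq_0 add.assoc diff_diff_eq simp flip: mult_2)
qed

lemma riesz_coeff_single: "j < N \<Longrightarrow> l = 256 ^ j \<or> l = - (256 ^ j) \<Longrightarrow> riesz_coeff N l = 1 / 2"
  using riesz_coeff_peak[of 0 j N l] by (simp add: riesz_coeff_zero)

text \<open>The peak rule applied at levels \<open>i\<close> and \<open>j\<close> gives 1/2 times
  1/2. This product structure is what makes the cosines uncorrelated.\<close>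

lemma riesz_coeff_pair:
  assumes "i < j" "j < N" "k = 256 ^ i \<or> k = - (256 ^ i)" "l = k + 256 ^ j \<or> l = k - 256 ^ j"
  shows "riesz_coeff N l = 1 / 4"
proof -
  have "(256::int) ^ Suc i \<le> 256 ^ j"
    using assms by (intro power_increasing) auto
  then have "3 * \<bar>k\<bar> < 256 ^ j"
    using assms(3) by (auto simp: power_Suc) (smt (verit) zero_less_power)+
  then show ?thesis
    using riesz_coeff_peak[of k j N l] riesz_coeff_single[of i j k] assms by auto
qed

section \<open>The Riesz measure as a weak limit\<close>

definition riesz_measure :: "nat \<Rightarrow> real measure" where
  "riesz_measure n = density lborel (\<lambda>x. ennreal (indicator {0..1} x * riesz n x))"

lemma borel_measurable_riesz [measurable]: "riesz n \<in> borel_measurable borel"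
  by (intro borel_measurable_continuous_onI continuous_intros)

lemma integral_riesz_measure:
  assumes "continuous_on UNIV h"
  shows "(CLINT x|riesz_measure n. cis (2 * pi * (k * x)) * h x) = riesz_integral h n k"
proof -
  have [measurable]: "h \<in> borel_measurable borel"
    using assms by (rule borel_measurable_continuous_onI)
  have [measurable]: "(\<lambda>x::real. cis (2 * pi * (k * x))) \<in> borel_measurable borel"
    by (intro borel_measurable_continuous_onI continuous_intros)
  show ?thesis
    unfolding riesz_measure_def riesz_integral_def set_lebesgue_integral_def
    by (subst integral_density)
       (auto simp: riesz_nonneg scaleR_conv_of_real intro!: Bochner_Integration.integral_cong split: split_indicator)
qed

text \<open>The total mass is the coefficient at frequency 0, which equals 1 for every finite
  product.\<close>

lemma real_distribution_riesz_measure: "real_distribution (riesz_measure n)"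
proof -
  have int: "integrable lborel (\<lambda>x. indicator {0..1} x * riesz n x)"
    using borel_integrable_atLeastAtMost'[of 0 1 "riesz n"]
    by (simp add: set_integrable_def continuous_on_riesz)
  have "complex_of_real (LINT x|lborel. indicator {0..1} x * riesz n x) = riesz_coeff n 0"
    unfolding riesz_integral_def set_lebesgue_integral_def
    by (subst integral_complex_of_real[symmetric])
       (auto intro!: Bochner_Integration.integral_cong split: split_indicator)
  then have "(LINT x|lborel. indicator {0..1} x * riesz n x) = 1"
    by (simp add: riesz_coeff_zero)
  then have "(\<integral>\<^sup>+x. ennreal (indicator {0..1} x * riesz n x) \<partial>lborel) = 1"
    using int by (subst nn_integral_eq_integral) (auto simp: riesz_nonneg)
  then have "prob_space (riesz_measure n)"
    unfolding riesz_measure_def by (intro prob_spaceI) (simp add: emeasure_density)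
  then show ?thesis
    by (simp add: real_distribution_def real_distribution_axioms_def riesz_measure_def)
qed

text \<open>Prepares tightness, which is phrased with intervals open on the left; the endpoint -1
  makes the interval contain the support \<open>{0..1}\<close>.\<close>

lemma measure_riesz_measure: "measure (riesz_measure n) {-1<..1} = 1"
proof -
  interpret real_distribution "riesz_measure n"
    by (rule real_distribution_riesz_measure)
  have "AE x in riesz_measure n. x \<in> {-1<..1}"
    unfolding riesz_measure_def by (subst AE_density) (auto split: split_indicator)
  then show ?thesis by (subst (asm) AE_in_set_eq_1) auto
qed

text \<open>\<open>M\<close> plays the part of the infinite Riesz product. Tightness of the finite
  products provides the subsequence \<open>r\<close>.\<close>

definition riesz_limit :: "real measure \<Rightarrow> (nat \<Rightarrow> nat) \<Rightarrow> bool" where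
  "riesz_limit M r \<longleftrightarrow> real_distribution M \<and> strict_mono r \<and>
     weak_conv_m (\<lambda>n. riesz_measure (r n)) M"

lemma ex_riesz_limit: "\<exists>M r. riesz_limit M r"
proof -
  have "tight riesz_measure"
    unfolding tight_def
  proof (intro conjI allI impI)
    show "real_distribution (riesz_measure n)" for n
      by (rule real_distribution_riesz_measure)
    show "\<exists>a b. a < b \<and> (\<forall>n. 1 - \<epsilon> < measure (riesz_measure n) {a<..b})" if "\<epsilon> > 0" for \<epsilon> :: real
      using that by (intro exI[of _ "-1"] exI[of _ 1]) (simp add: measure_riesz_measure)
  qed
  from tight_imp_convergent_subsubsequence[OF this strict_mono_id] show ?thesis
    by (auto simp: riesz_limit_def o_def)
qed

lemma riesz_limit_integral:
  assumes M: "riesz_limit M r" and h: "continuous_on UNIV h" "\<And>x. norm (h x) \<le> 1"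
  shows "(\<lambda>n. riesz_integral h (r n) k) \<longlonglongrightarrow> (CLINT x|M. cis (2 * pi * (k * x)) * h x)"
proof -
  have "(\<lambda>n. CLINT x|riesz_measure (r n). cis (2 * pi * (k * x)) * h x) \<longlonglongrightarrow>
      (CLINT x|M. cis (2 * pi * (k * x)) * h x)"
  proof (rule weak_conv_imp_integral_bdd_continuous_conv)
    have "continuous_on UNIV (\<lambda>x::real. cis (2 * pi * (k * x)) * h x)"
      using h by (intro continuous_intros)
    then show "isCont (\<lambda>x. cis (2 * pi * (k * x)) * h x) x" for x :: real
      by (simp add: continuous_on_eq_continuous_at)
    show "norm (cis (2 * pi * (k * x)) * h x) \<le> 1" for x :: real
      using h by (simp add: norm_mult)
    show "real_distribution M" "weak_conv_m (\<lambda>n. riesz_measure (r n)) M"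
      using M by (simp_all add: riesz_limit_def)
  qed (rule real_distribution_riesz_measure)
  then show ?thesis by (simp add: integral_riesz_measure h)
qed

lemma (in real_distribution) integrable_continuous_bounded:
  fixes f :: "real \<Rightarrow> 'b::{banach, second_countable_topology}"
  assumes "continuous_on UNIV f" "\<And>x. norm (f x) \<le> B"
  shows "integrable M f"
  using borel_measurable_continuous_onI[OF assms(1)] assms(2)
  by (intro integrable_const_bound[where B = B]) (auto simp: measurable_def)

text \<open>The coefficients of the finite products are constant from \<open>N\<close> on, and
  \<open>r n \<ge> n\<close>, so weak convergence hands the constant to \<open>M\<close>.\<close>

lemma riesz_limit_cos:
  assumes M: "riesz_limit M r" and c: "\<And>n. n \<ge> N \<Longrightarrow> riesz_coeff n k = c"
  shows "(LINT x|M. cos (2 * pi * (k * x))) = Re c"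
proof -
  interpret real_distribution M using M by (simp add: riesz_limit_def)
  have "(\<lambda>n. riesz_coeff (r n) k) \<longlonglongrightarrow> (CLINT x|M. cis (2 * pi * (k * x)) * 1)"
    using M by (intro riesz_limit_integral) auto
  moreover have "(\<lambda>n. riesz_coeff (r n) k) \<longlonglongrightarrow> c"
  proof (rule tendsto_eventually)
    show "\<forall>\<^sub>F n in sequentially. riesz_coeff (r n) k = c"
      using eventually_ge_at_top[of N]
    proof eventually_elim
      case (elim n)
      then show ?case
        using M seq_suble[of r n] by (intro c) (auto simp: riesz_limit_def)
    qed
  qed
  ultimately have c: "(CLINT x|M. cis (2 * pi * (k * x))) = c"
    using LIMSEQ_unique by fastforce
  have "integrable M (\<lambda>x. cis (2 * pi * (k * x)))"
    by (intro integrable_continuous_bounded[where B = 1] continuous_intros) auto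
  from integral_Re[OF this] show ?thesis
    by (simp add: c)
qed

section \<open>Almost sure convergence of the cosine averages\<close>

definition cos_average :: "nat \<Rightarrow> real \<Rightarrow> real" where
  "cos_average n x = (\<Sum>j<n. cos (2 * pi * (256 ^ j * x))) / n"

lemma continuous_on_cos_average [continuous_intros]: "continuous_on S (cos_average n)"
  unfolding cos_average_def[abs_def]
  by (cases "n = 0") (auto intro!: continuous_intros)

lemma borel_measurable_cos_average [measurable]: "cos_average n \<in> borel_measurable borel"
  by (intro borel_measurable_continuous_onI continuous_intros)

lemma abs_cos_average_le: "\<bar>cos_average n x\<bar> \<le> 1"
proof -
  have "\<bar>\<Sum>j<n. cos (2 * pi * (256 ^ j * x))\<bar> \<le> (\<Sum>j<n. 1)"
    by (intro order_trans[OF sum_abs] sum_mono) simp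
  then show ?thesis by (cases "n = 0") (simp_all add: cos_average_def abs_divide divide_le_eq_1)
qed

text \<open>Expand the square into covariances of the centred cosines \<open>Y j\<close>. Off the
  diagonal they vanish; the \<open>n\<close> diagonal ones are at most 9/4, since
  \<open>|Y j| \<le> 3/2\<close>. Division by \<open>n^2\<close> leaves
  \<open>1 / n\<close>.\<close>

lemma riesz_limit_variance:
  assumes M: "riesz_limit M r" and "n > 0"
  shows "(LINT x|M. (cos_average n x - 1/2)\<^sup>2) \<le> 9 / (4 * real n)"
proof -
  interpret real_distribution M using M by (simp add: riesz_limit_def)
  define C where "C k x = cos (2 * pi * (real_of_int k * x))" for k x
  define Y where "Y j x = C (256 ^ j) x - 1/2" for j x
  have bound: "\<bar>Y j x\<bar> \<le> 3/2" for j x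
    using cos_le_one[of "2 * pi * (real_of_int (256 ^ j) * x)"] cos_ge_minus_one[of "2 * pi * (real_of_int (256 ^ j) * x)"]
    unfolding Y_def C_def by linarith
  have YY: "\<bar>Y i x * Y j x\<bar> \<le> 9/4" for i j x
    using mult_mono[OF bound[of i x] bound[of j x]] by (simp add: abs_mult)
  have cC: "continuous_on UNIV (C k)" for k
    unfolding C_def[abs_def] by (intro continuous_intros)
  then have cY: "continuous_on UNIV (Y j)" for j
    unfolding Y_def[abs_def] by (intro continuous_intros)
  have iC: "integrable M (C k)" for k
    using cC by (intro integrable_continuous_bounded[where B = 1]) (auto simp: C_def)
  have iYY: "integrable M (\<lambda>x. Y i x * Y j x)" for i j
    using cY YY by (intro integrable_continuous_bounded[where B = "9/4"] continuous_intros) auto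
  have off: "(LINT x|M. Y i x * Y j x) = 0" if "i < j" for i j
  proof -
    \<comment> \<open>Under \<open>M\<close> each frequency
      \<open>256 ^ j \<plusminus> 256 ^ i\<close> has mean 1/4 and each single one 1/2, so the total
      is 1/4 - 1/2 + 1/4 = 0.\<close>
    have "Y i x * Y j x = (C (256 ^ j + 256 ^ i) x + C (256 ^ j - 256 ^ i) x) / 2
        - (C (256 ^ i) x + C (256 ^ j) x) / 2 + 1/4" for x
    proof -
      have "C (256 ^ i) x * C (256 ^ j) x = (C (256 ^ j + 256 ^ i) x + C (256 ^ j - 256 ^ i) x) / 2"
        unfolding C_def using cos_times_cos[of "2 * pi * (256 ^ j * x)" "2 * pi * (256 ^ i * x)"]
        by (simp add: algebra_simps)
      then show ?thesis by (simp add: Y_def field_simps)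
    qed
    then have "(LINT x|M. Y i x * Y j x) = ((LINT x|M. C (256 ^ j + 256 ^ i) x) + (LINT x|M. C (256 ^ j - 256 ^ i) x)) / 2
        - ((LINT x|M. C (256 ^ i) x) + (LINT x|M. C (256 ^ j) x)) / 2 + 1/4"
      using iC prob_space by simp
    moreover have "(LINT x|M. C (256 ^ j + 256 ^ i) x) = Re (1/4)"
      unfolding C_def using that riesz_coeff_pair[of i j _ "256 ^ i"]
      by (intro riesz_limit_cos[OF M, of "Suc j"]) simp
    moreover have "(LINT x|M. C (256 ^ j - 256 ^ i) x) = Re (1/4)"
      unfolding C_def using that riesz_coeff_pair[of i j _ "- (256 ^ i)"]
      by (intro riesz_limit_cos[OF M, of "Suc j"]) simp
    moreover have "(LINT x|M. C (256 ^ i) x) = Re (1/2)" for i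
      unfolding C_def using riesz_coeff_single[of i _ "256 ^ i"]
      by (intro riesz_limit_cos[OF M, of "Suc i"]) simp
    ultimately show ?thesis by simp
  qed
  have entry: "(LINT x|M. Y i x * Y j x) \<le> (if i = j then 9/4 else 0)" for i j
  proof (cases i j rule: linorder_cases)
    case less
    then show ?thesis using off[of i j] by simp
  next
    case equal
    have "(LINT x|M. Y i x * Y j x) \<le> (LINT x|M. 9/4)"
    proof (rule integral_mono[OF iYY])
      show "Y i x * Y j x \<le> 9/4" for x using YY[of i x j] by linarith
    qed simp
    then show ?thesis using equal prob_space by simp
  next
    case greater
    then show ?thesis using off[of j i] by (simp add: mult.commute)
  qed
  have "(cos_average n x - 1/2)\<^sup>2 = (\<Sum>i<n. \<Sum>j<n. Y i x * Y j x) / n\<^sup>2" for x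
  proof -
    have "cos_average n x - 1/2 = (\<Sum>j<n. Y j x) / n"
      using \<open>n > 0\<close> by (simp add: cos_average_def Y_def C_def sum_subtractf diff_divide_distrib)
    then show ?thesis
      by (simp add: power2_eq_square sum_product)
  qed
  then have "(LINT x|M. (cos_average n x - 1/2)\<^sup>2) = (\<Sum>i<n. \<Sum>j<n. LINT x|M. Y i x * Y j x) / n\<^sup>2"
    using iYY by (simp add: integral_sum)
  also have "\<dots> \<le> (\<Sum>i<n. \<Sum>j<n. if i = j then 9/4 else 0) / n\<^sup>2"
    using entry by (intro divide_right_mono sum_mono) auto
  also have "\<dots> = 9 / (4 * real n)"
    using \<open>n > 0\<close> by (simp add: sum.delta power2_eq_square)
  finally show ?thesis .
qed

text \<open>The variance bound is convergence to 0 in L1 of the squared deviations, and this yields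
  almost everywhere convergence along a subsequence.\<close>

lemma riesz_limit_cos_average_AE:
  assumes M: "riesz_limit M r"
  obtains s where "AE x in M. (\<lambda>n. cos_average (s n) x) \<longlonglongrightarrow> 1/2" "strict_mono s"
proof -
  interpret real_distribution M using M by (simp add: riesz_limit_def)
  have bound: "\<bar>cos_average n x - 1/2\<bar> \<le> 2" for n x
    using abs_cos_average_le[of n x] by linarith
  have int: "integrable M (\<lambda>x. (cos_average n x - 1/2)\<^sup>2)" for n
  proof (rule integrable_continuous_bounded)
    show "norm ((cos_average n x - 1/2)\<^sup>2) \<le> 2\<^sup>2" for x
      using power_mono[OF bound[of n x], of 2] by simp
  qed (intro continuous_intros)
  have "(\<lambda>n. LINT x|M. norm ((cos_average n x - 1/2)\<^sup>2)) \<longlonglongrightarrow> 0"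
  proof (rule tendsto_sandwich[where f = "\<lambda>_. 0" and h = "\<lambda>n. 9 / (4 * real n)"])
    show "\<forall>\<^sub>F n in sequentially. (LINT x|M. norm ((cos_average n x - 1/2)\<^sup>2)) \<le> 9 / (4 * real n)"
      using eventually_gt_at_top[of 0] by eventually_elim (use riesz_limit_variance[OF M] in simp)
    show "(\<lambda>n. 9 / (4 * real n)) \<longlonglongrightarrow> 0"
      using tendsto_mult_right_zero[OF lim_inverse_n, of "9/4"] by (simp add: field_simps)
  next
    show "\<forall>\<^sub>F n in sequentially. 0 \<le> (LINT x|M. norm ((cos_average n x - 1/2)\<^sup>2))"
      by (intro always_eventually allI integral_nonneg) auto
  qed (rule tendsto_const)
  from tendsto_L1_AE_subseq[OF int this] obtain s where s: "strict_mono s"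
    "AE x in M. (\<lambda>n. (cos_average (s n) x - 1/2)\<^sup>2) \<longlonglongrightarrow> 0" by auto
  from s(2) have "AE x in M. (\<lambda>n. cos_average (s n) x) \<longlonglongrightarrow> 1/2"
  proof eventually_elim
    case (elim x)
    from tendsto_real_sqrt[OF elim] have "(\<lambda>n. \<bar>cos_average (s n) x - 1/2\<bar>) \<longlonglongrightarrow> 0"
      unfolding real_sqrt_abs real_sqrt_zero .
    then have "(\<lambda>n. cos_average (s n) x - 1/2) \<longlonglongrightarrow> 0"
      by (rule tendsto_rabs_zero_cancel)
    then show ?case by (rule LIM_zero_cancel)
  qed
  with s(1) that show ?thesis by blast
qed

section \<open>Fourier dimensions\<close>

lemma fourier_transform_cis:
  "fourier_transform M \<xi> = (CLINT x|M. cis (- (2 * pi * (\<xi> * x))))"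
  by (simp add: fourier_transform_def cis_conv_exp mult_ac)

lemma (in real_distribution) norm_fourier_transform_le_1: "cmod (fourier_transform M \<xi>) \<le> 1"
proof -
  have "cmod (fourier_transform M \<xi>) \<le> (LINT x|M. norm (cis (- (2 * pi * (\<xi> * x)))))"
    unfolding fourier_transform_cis by (rule integral_norm_bound)
  then show ?thesis using prob_space by simp
qed

lemma (in real_distribution) Re_fourier_transform:
  "Re (fourier_transform M \<xi>) = (LINT x|M. cos (2 * pi * (\<xi> * x)))"
proof -
  have "integrable M (\<lambda>x. cis (- (2 * pi * (\<xi> * x))))"
    by (intro integrable_continuous_bounded[where B = 1] continuous_intros) auto
  from integral_Re[OF this] show ?thesis
    by (simp add: fourier_transform_cis)
qed

lemma (in real_distribution) fourier_dim_measure_le: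
  assumes "\<And>s. 0 \<le> s \<Longrightarrow> s \<le> 1 \<Longrightarrow>
    bounded (range (\<lambda>\<xi>. cmod (fourier_transform M \<xi>) * \<bar>\<xi>\<bar> powr (s / 2))) \<Longrightarrow> s \<le> d"
  shows "fourier_dim_measure M \<le> d"
  unfolding fourier_dim_measure_def
proof (rule cSup_least)
  \<comment> \<open>The exponent 0 always qualifies, so the supremum is over a nonempty set. The
    case \<open>\<xi> = 0\<close> is separate because \<open>0 powr 0 = 0\<close>.\<close>
  have "cmod (fourier_transform M \<xi>) * \<bar>\<xi>\<bar> powr (0 / 2) \<le> 1" for \<xi>
    using norm_fourier_transform_le_1[of \<xi>] by (cases "\<xi> = 0") auto
  then have "bounded (range (\<lambda>\<xi>. cmod (fourier_transform M \<xi>) * \<bar>\<xi>\<bar> powr (0 / 2)))"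
    by (intro boundedI[of _ 1]) auto
  then have "0 \<in> {s \<in> {0..1}. bounded (range (\<lambda>\<xi>. cmod (fourier_transform M \<xi>) * \<bar>\<xi>\<bar> powr (s / 2)))}"
    by simp
  then show "{s \<in> {0..1}. bounded (range (\<lambda>\<xi>. cmod (fourier_transform M \<xi>) * \<bar>\<xi>\<bar> powr (s / 2)))} \<noteq> {}"
    by blast
qed (use assms in simp)

lemma fourier_dim_measure_ge:
  assumes "s \<in> {0..1}" "bounded (range (\<lambda>\<xi>. cmod (fourier_transform M \<xi>) * \<bar>\<xi>\<bar> powr (s / 2)))"
  shows "s \<le> fourier_dim_measure M"
  unfolding fourier_dim_measure_def using assms
  by (intro cSup_upper) (auto intro!: bdd_aboveI[of _ 1])

lemma fourier_dim_ge:
  assumes "real_distribution M" "measure M F = 1"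
  shows "fourier_dim_measure M \<le> fourier_dim F"
proof -
  have "F \<noteq> {}" using assms by auto
  moreover have "bdd_above {fourier_dim_measure M | M. real_distribution M \<and> measure M F = 1}"
    by (intro bdd_aboveI[of _ 1]) (auto intro: real_distribution.fourier_dim_measure_le)
  ultimately show ?thesis
    unfolding fourier_dim_def using assms by (auto intro!: cSup_upper)
qed

section \<open>Measures on the set of convergence have dimension zero\<close>

text \<open>Power decay sampled at the frequencies \<open>256 ^ j\<close> is geometric decay. The
  integrals of the cosines are therefore summable, and their averages tend to 0.\<close>

lemma (in real_distribution) integral_cos_average_tendsto_0:
  assumes "s > 0" and bdd: "bounded (range (\<lambda>\<xi>. cmod (fourier_transform M \<xi>) * \<bar>\<xi>\<bar> powr (s / 2)))"
  shows "(\<lambda>n. LINT x|M. cos_average n x) \<longlonglongrightarrow> 0"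
proof -
  define \<rho> where "\<rho> = (256::real) powr (- s / 2)"
  have \<rho>: "0 < \<rho>" "\<rho> < 1"
    using \<open>s > 0\<close> by (auto simp: \<rho>_def powr_less_one)
  define a where "a j = (LINT x|M. cos (2 * pi * (256 ^ j * x)))" for j :: nat
  obtain B where B: "cmod (fourier_transform M \<xi>) * \<bar>\<xi>\<bar> powr (s / 2) \<le> B" for \<xi>
    using bdd by (auto simp: bounded_iff)
  have a_le: "norm (a j) \<le> B * \<rho> ^ j" for j
  proof -
    have "\<bar>256 ^ j\<bar> powr (s / 2) * \<rho> ^ j = (256 powr real j) powr (s / 2) * (\<rho> powr real j)"
      using \<rho> by (simp only: powr_realpow abs_of_pos zero_less_power zero_less_numeral)
    also have "\<dots> = 256 powr (real j * (s / 2) + - s / 2 * real j)"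
      by (simp only: \<rho>_def powr_powr powr_add)
    also have "\<dots> = 1" by simp
    finally have p: "\<bar>256 ^ j\<bar> powr (s / 2) * \<rho> ^ j = 1" .
    have "norm (a j) \<le> cmod (fourier_transform M (256 ^ j))"
      using abs_Re_le_cmod[of "fourier_transform M (256 ^ j)"] by (simp only: a_def Re_fourier_transform real_norm_def)
    also have "\<dots> = cmod (fourier_transform M (256 ^ j)) * \<bar>256 ^ j\<bar> powr (s / 2) * \<rho> ^ j"
      using p by (simp only: mult.assoc mult_1_right)
    also have "\<dots> \<le> B * \<rho> ^ j"
      using \<rho> by (intro mult_right_mono B) simp
    finally show ?thesis .
  qed
  have "summable (\<lambda>j. B * \<rho> ^ j)"
    using \<rho> by (intro summable_mult summable_geometric) auto
  then have "summable a"
    by (rule summable_comparison_test'[where N = 0]) (rule a_le)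
  from tendsto_mult[OF summable_LIMSEQ[OF this] lim_1_over_n]
  have "(\<lambda>n. (\<Sum>j<n. a j) * (1 / real n)) \<longlonglongrightarrow> 0"
    by simp
  moreover have "(LINT x|M. cos_average n x) = (\<Sum>j<n. a j) * (1 / real n)" for n
  proof -
    have "integrable M (\<lambda>x. cos (2 * pi * (256 ^ j * x)))" for j :: nat
      by (intro integrable_continuous_bounded[where B = 1] continuous_intros) auto
    then have "(LINT x|M. (\<Sum>j<n. cos (2 * pi * (256 ^ j * x)))) = (\<Sum>j<n. a j)"
      unfolding a_def by (intro Bochner_Integration.integral_sum)
    then show ?thesis
      unfolding cos_average_def by simp
  qed
  ultimately show ?thesis by simp
qed

text \<open>Dominated convergence makes the integrals of the averages tend to 1/2 along
  \<open>s\<close>; decay with a positive exponent would force the limit 0.\<close>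

lemma fourier_dim_measure_cos_average_limit:
  assumes "strict_mono s" and "real_distribution M"
    and F: "measure M {x. (\<lambda>n. cos_average (s n) x) \<longlonglongrightarrow> 1/2} = 1" (is "measure M ?F = 1")
  shows "fourier_dim_measure M \<le> 0"
proof -
  interpret real_distribution M by fact
  have "?F \<in> sets borel" by measurable
  then have AE: "AE x in M. (\<lambda>n. cos_average (s n) x) \<longlonglongrightarrow> 1/2"
    using AE_in_set_eq_1[of ?F] F by simp
  have lim: "(\<lambda>n. LINT x|M. cos_average (s n) x) \<longlonglongrightarrow> (LINT x|M. 1/2)"
    by (rule integral_dominated_convergence[where w = "\<lambda>_. 1"])
       (use AE abs_cos_average_le in \<open>simp_all add: borel_measurable_cos_average\<close>)
  show ?thesis
  proof (rule fourier_dim_measure_le, rule ccontr)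
    fix t assume "\<not> t \<le> 0" "bounded (range (\<lambda>\<xi>. cmod (fourier_transform M \<xi>) * \<bar>\<xi>\<bar> powr (t / 2)))"
    then have "(\<lambda>n. LINT x|M. cos_average n x) \<longlonglongrightarrow> 0"
      by (intro integral_cos_average_tendsto_0) auto
    from LIMSEQ_unique[OF LIMSEQ_subseq_LIMSEQ[OF this \<open>strict_mono s\<close>, unfolded o_def] lim] prob_space
    show False by simp
  qed
qed

section \<open>Fourier decay of the image measure\<close>

text \<open>The increment from \<open>n\<close> to \<open>n + 1\<close> factors is the mean of the
  integrals at frequencies \<open>256 ^ n\<close> and \<open>- 256 ^ n\<close>. Each is
  \<open>O(2^-n |\<xi>|^(-1/4))\<close>, so the increments sum to a bound independent of
  \<open>n\<close>.\<close>

lemma riesz_integral_expand_le: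
  assumes "\<bar>\<xi>\<bar> \<ge> 1"
  shows "norm (riesz_integral (\<lambda>x. cis (- (2 * pi * (\<xi> * expand x)))) n 0) \<le> 100 / \<bar>\<xi>\<bar> powr (1/4)"
proof -
  define h where "h x = cis (- (2 * pi * (\<xi> * expand x)))" for x
  define a where "a = \<bar>\<xi>\<bar> powr (1/4)"
  have "a > 0" using assms by (simp add: a_def)
  have "continuous_on UNIV expand"
    using DERIV_expand by (intro DERIV_continuous_on) (auto intro: has_field_derivative_at_within)
  then have h: "continuous_on S h" for S
    unfolding h_def[abs_def] by (intro continuous_intros) (auto intro: continuous_on_subset)
  have J0: "riesz_integral h 0 k = integral {0..1} (\<lambda>x. cis (2 * pi * (k * x - \<xi> * expand x)))" for k
  proof -
    have "riesz_integral h 0 k = (CLINT x:{0..1}|lborel. cis (2 * pi * (k * x - \<xi> * expand x)))"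
      by (simp add: riesz_integral_def riesz_def h_def cis_mult algebra_simps)
    also have "\<dots> = integral {0..1} (\<lambda>x. cis (2 * pi * (k * x - \<xi> * expand x)))"
      using \<open>continuous_on UNIV expand\<close>
      by (intro set_borel_integral_eq_integral borel_integrable_atLeastAtMost' continuous_intros)
         (auto intro: continuous_on_subset)
    finally show ?thesis .
  qed
  have resonance: "norm (riesz_integral h n l) \<le> 40 / a * (1/2) ^ n" if "\<bar>l\<bar> = 256 ^ n" for n l
  proof -
    \<comment> \<open>The factor \<open>2 ^ n\<close> is the weight of the expansion, and
      \<open>4 ^ n / 2\<close> is an admissible \<open>c\<close> in
      \<open>expand_integral_le\<close>: its fourth power is \<open>256 ^ n / 16\<close>.\<close>
    have "norm (riesz_integral h n l) \<le> 2 ^ n * (20 / (a * (4 ^ n / 2)))"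
    proof (rule norm_riesz_integral_le[OF h])
      fix k assume k: "\<bar>l\<bar> - (\<Sum>j<n. 256 ^ j) \<le> \<bar>k\<bar>"
      \<comment> \<open>The summand 1 gives \<open>|k| \<ge> 1\<close> also for
        \<open>n = 0\<close>.\<close>
      have "256 ^ n + 1 \<le> 2 * \<bar>k\<bar>"
        using k that sum_256_power[of n] zero_less_power[of "256::int" n] by linarith
      then have "real_of_int (256 ^ n + 1) \<le> real_of_int (2 * \<bar>k\<bar>)"
        by (simp only: of_int_le_iff)
      then have K: "256 ^ n + 1 \<le> 2 * \<bar>real_of_int k\<bar>" by simp
      have "((4::real) ^ n) ^ 4 = (4 ^ 4) ^ n"
        by (metis power_mult mult.commute)
      then have "(4 ^ n / 2 :: real) ^ 4 = 256 ^ n / 16"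
        by (simp add: power_divide)
      moreover have "(1::real) \<le> 256 ^ n" by simp
      with K have "1 \<le> \<bar>real_of_int k\<bar>" "256 ^ n / 16 \<le> \<bar>real_of_int k\<bar>" by linarith+
      ultimately show "norm (riesz_integral h 0 k) \<le> 20 / (a * (4 ^ n / 2))"
        unfolding J0 a_def using assms by (intro expand_integral_le) auto
    qed
    also have "\<dots> = 40 / a * (1/2) ^ n"
    proof -
      have "(4::real) ^ n = 2 ^ n * 2 ^ n" by (simp flip: power_mult_distrib)
      then show ?thesis using \<open>a > 0\<close> by (simp add: field_simps)
    qed
    finally show ?thesis .
  qed
  \<comment> \<open>The term \<open>20 / a\<close> bounds the integral without any factor; the sum
    collects the increments and is at most 2, whence 100 = 20 + 40 * 2.\<close>
  have "norm (riesz_integral h n 0) \<le> 20 / a + 40 / a * (\<Sum>j<n. (1/2) ^ j)"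
  proof (induction n)
    case 0
    have sqrt_eq: "sqrt \<bar>\<xi>\<bar> = a * a"
      using assms by (simp add: a_def powr_half_sqrt flip: powr_add)
    have "a \<ge> 1" using assms by (simp add: a_def ge_one_powr_ge_zero)
    then have "10 / sqrt \<bar>\<xi>\<bar> \<le> 20 / a"
      unfolding sqrt_eq by (intro frac_le) auto
    moreover have "\<xi> \<noteq> 0" using assms by auto
    ultimately show ?case
      using expand_integral_le_frequency[of \<xi> 0] by (simp add: J0)
  next
    case (Suc n)
    have "norm (riesz_integral h (Suc n) 0) \<le> norm (riesz_integral h n 0)
        + norm (riesz_integral h n (256 ^ n) + riesz_integral h n (- (256 ^ n))) / 2"
      unfolding riesz_integral_Suc[OF h] using norm_triangle_ineq
      by (metis add_0 diff_0 norm_divide norm_numeral)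
    also have "norm (riesz_integral h n (256 ^ n) + riesz_integral h n (- (256 ^ n))) \<le> 40 / a * (1/2) ^ n + 40 / a * (1/2) ^ n"
      by (intro order_trans[OF norm_triangle_ineq] add_mono resonance) auto
    finally show ?case
      using Suc.IH by (simp add: algebra_simps)
  qed
  also have "\<dots> \<le> 20 / a + 40 / a * 2"
  proof -
    have "(\<Sum>j<n. (1/2) ^ j) \<le> (2 :: real)"
      using geometric_sum[of "1/2 :: real" n] by simp
    then show ?thesis using \<open>a > 0\<close> by (intro add_left_mono mult_left_mono) auto
  qed
  also have "\<dots> = 100 / a" by simp
  finally show ?thesis unfolding h_def[abs_def] a_def .
qed

text \<open>The bound for finite products is uniform, so it passes to the weak limit. Decay of order
  1/4 is the exponent \<open>s / 2\<close> for \<open>s = 1/2\<close>; for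
  \<open>|\<xi>| < 1\<close> the trivial bound 1 is enough.\<close>

lemma fourier_dim_measure_distr_expand:
  assumes M: "riesz_limit M r"
  shows "1/2 \<le> fourier_dim_measure (distr M borel expand)"
proof -
  interpret real_distribution M using M by (simp add: riesz_limit_def)
  have cont: "continuous_on UNIV expand"
    using DERIV_expand by (intro DERIV_continuous_on) (auto intro: has_field_derivative_at_within)
  then have meas: "expand \<in> borel_measurable M"
    using borel_measurable_continuous_onI by (simp add: measurable_def)
  interpret D: real_distribution "distr M borel expand"
    using meas by (rule real_distribution_distr)
  have decay: "cmod (fourier_transform (distr M borel expand) \<xi>) \<le> 100 / \<bar>\<xi>\<bar> powr (1/4)" if "\<bar>\<xi>\<bar> \<ge> 1" for \<xi>
  proof -
    let ?h = "\<lambda>x. cis (- (2 * pi * (\<xi> * expand x)))"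
    have "(\<lambda>x. cis (- (2 * pi * (\<xi> * x)))) \<in> borel_measurable borel"
      by (intro borel_measurable_continuous_onI continuous_intros)
    then have "fourier_transform (distr M borel expand) \<xi> = (CLINT x|M. ?h x)"
      unfolding fourier_transform_cis using meas by (subst integral_distr) auto
    moreover have "(\<lambda>n. riesz_integral ?h (r n) 0) \<longlonglongrightarrow> (CLINT x|M. cis (2 * pi * (real_of_int 0 * x)) * ?h x)"
      using cont by (intro riesz_limit_integral[OF M] continuous_intros) auto
    ultimately have "(\<lambda>n. riesz_integral ?h (r n) 0) \<longlonglongrightarrow> fourier_transform (distr M borel expand) \<xi>"
      by simp
    then have "(\<lambda>n. cmod (riesz_integral ?h (r n) 0)) \<longlonglongrightarrow> cmod (fourier_transform (distr M borel expand) \<xi>)"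
      by (rule tendsto_norm)
    then show ?thesis
      by (rule LIMSEQ_le_const2) (use riesz_integral_expand_le[OF that] in auto)
  qed
  have "cmod (fourier_transform (distr M borel expand) \<xi>) * \<bar>\<xi>\<bar> powr ((1/2) / 2) \<le> 100" for \<xi>
  proof (cases "\<bar>\<xi>\<bar> \<ge> 1")
    case True
    then show ?thesis using decay[OF True] by (simp add: field_simps)
  next
    case False
    have "cmod (fourier_transform (distr M borel expand) \<xi>) * \<bar>\<xi>\<bar> powr ((1/2) / 2) \<le> 1 * 1"
      using False D.norm_fourier_transform_le_1 by (intro mult_mono powr_le1) auto
    then show ?thesis by simp
  qed
  then show ?thesis
    by (intro fourier_dim_measure_ge boundedI[of _ 100]) auto
qed

section \<open>Comparison of the set of convergence with its image\<close>

theorem mainTheorem7: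
  fixes m :: nat
  assumes "m \<ge> 1"
  shows "\<exists>(F :: real set) (f :: real \<Rightarrow> real).
    F \<in> sets borel \<and> C_m_diffeomorphism m f \<and> fourier_dim (f ` F) \<noteq> fourier_dim F"
proof -
  obtain M r where M: "riesz_limit M r"
    using ex_riesz_limit by blast
  interpret real_distribution M using M by (simp add: riesz_limit_def)
  obtain s where s: "AE x in M. (\<lambda>n. cos_average (s n) x) \<longlonglongrightarrow> 1/2" "strict_mono s"
    using riesz_limit_cos_average_AE[OF M] .
  define F where "F = {x. (\<lambda>n. cos_average (s n) x) \<longlonglongrightarrow> 1/2}"
  have F: "F \<in> sets borel"
    unfolding F_def by measurable
  have "measure M F = 1"
    using s(1) F by (subst AE_in_set_eq_1[symmetric]) (auto simp: F_def)
  have "continuous_on UNIV expand" "continuous_on UNIV (inv expand)"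
    using C_m_expand[of 0] C_m_inv_expand[of 0] by (simp_all add: C_m_def)
  then have meas: "expand \<in> borel_measurable M" "inv expand \<in> borel_measurable borel"
    using borel_measurable_continuous_onI by (simp_all add: measurable_def)
  \<comment> \<open>Writing the image as a preimage under the continuous inverse shows that it is
    Borel.\<close>
  have "expand ` F = inv expand -` F"
    using bij_vimage_eq_inv_image[OF bij_imp_bij_inv[OF bij_expand]] by (simp add: inv_inv_eq bij_expand)
  then have image: "expand ` F \<in> sets borel"
    using measurable_sets[OF meas(2) F] by simp
  have "expand -` expand ` F = F"
    using bij_expand by (simp add: bij_is_inj inj_vimage_image_eq)
  then have "measure (distr M borel expand) (expand ` F) = 1"
    using \<open>measure M F = 1\<close> by (simp add: measure_distr[OF meas(1) image])
  then have "1/2 \<le> fourier_dim (expand ` F)"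
    using fourier_dim_ge[of "distr M borel expand"] fourier_dim_measure_distr_expand[OF M]
      real_distribution_distr[OF meas(1)] by force
  moreover have "fourier_dim F \<le> 0"
  proof -
    have "F \<noteq> {}" using \<open>measure M F = 1\<close> by auto
    moreover have "Sup {fourier_dim_measure N | N. real_distribution N \<and> measure N F = 1} \<le> 0"
    proof (rule cSup_least)
      \<comment> \<open>\<open>M\<close> itself lives on \<open>F\<close>, so the supremum is taken
        over a nonempty set and is not a default value.\<close>
      have "real_distribution M" by unfold_locales
      then show "{fourier_dim_measure N | N. real_distribution N \<and> measure N F = 1} \<noteq> {}"
        using \<open>measure M F = 1\<close> by blast
    qed (use fourier_dim_measure_cos_average_limit[OF s(2)] in \<open>auto simp: F_def\<close>)
    ultimately show ?thesis by (simp add: fourier_dim_def)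
  qed
  ultimately have "fourier_dim (expand ` F) \<noteq> fourier_dim F" by linarith
  moreover have "C_m_diffeomorphism m expand"
    by (simp add: C_m_diffeomorphism_def bij_expand C_m_expand C_m_inv_expand)
  ultimately show ?thesis using F by blast
qed

end
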